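(* Let $A\in\mathbb{R}^{m\times n}$ be such that $|\rho_A^-|>0$. For $b\in\mathbb{R}^m$ let $W=\{x\in\mathbb{R}^n : x\ge\mathbf{0},\ Ax=b\}$. If $W\neq\emptyset$, then for all $x\in\mathbb{R}^n$ with $x\ge\mathbf{0}$, $$\mathrm{dist}_1(x,W)\le\frac{\|Ax-b\|}{|\rho_A^-|},$$ where $\mathrm{dist}_1(x,W)=\inf_{y\in W}\|x-y\|_1$ is the distance from $x$ to $W$ in the $\ell_1$ norm.
   Context: $\mathrm{lin}(A)=\{A\alpha:\alpha\in\mathbb{R}^n\}\subseteq\mathbb{R}^m$ is the linear span of the columns of $A$; $\triangle=\{p\in\mathbb{R}^n: p\ge\mathbf{0},\ \|p\|_1=1\}$ is the probability simplex; $\|\cdot\|$ is the Euclidean norm; vector inequalities are componentwise. The affine-margin of $A$ is $\rho_A:=\sup\{\inf_{p\in\triangle}w^TAp : w\in\mathrm{lin}(A),\ \|w\|=1\}$, and $\rho_A^-:=\min\{0,\rho_A\}$. (In the degenerate case $A=0$ the supremum is over the empty set and equals $-\infty$, and division by $\infty$ gives $0$.) *)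

theory Defs
  imports "HOL-Analysis.Analysis"
begin

definition l1_norm :: "real ^ 'n \<Rightarrow> real" where
  "l1_norm x = (\<Sum>i\<in>UNIV. \<bar>x $ i\<bar>)"

definition lin :: "real ^ 'n ^ 'm \<Rightarrow> (real ^ 'm) set" where
  "lin A = {A *v \<alpha> | \<alpha>. True}"

definition prob_simplex :: "(real ^ 'n) set" where
  "prob_simplex = {p. 0 \<le> p \<and> l1_norm p = 1}"

text \<open>
  The margin is \<^typ>\<open>ereal\<close>-valued: for \<open>A = 0\<close> no unit vector lies in
  \<open>lin A\<close>, and the supremum over the empty set is \<open>-\<infinity>\<close>.
\<close>

definition affine_margin :: "real ^ 'n ^ 'm \<Rightarrow> ereal" where
  "affine_margin A =
     (SUP w\<in>{w \<in> lin A. norm w = 1}. INF p\<in>prob_simplex. ereal (w \<bullet> (A *v p)))"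

definition affine_margin_neg :: "real ^ 'n ^ 'm \<Rightarrow> ereal" where
  "affine_margin_neg A = min 0 (affine_margin A)"

text \<open>
  The infimum is the real one, hence meaningful only for nonempty \<open>W\<close>
  (the values are bounded below by \<open>0\<close>).
\<close>

definition dist_l1 :: "real ^ 'n \<Rightarrow> (real ^ 'n) set \<Rightarrow> real" where
  "dist_l1 x W = (INF y\<in>W. l1_norm (x - y))"

end

theory Submission
  imports Defs
begin

text \<open>
  If \<open>\<rho>\<^sub>A \<le> -r < 0\<close>, then the image of the simplex contains the ball of radius \<open>r\<close> in
  \<open>lin A\<close>: otherwise a hyperplane separating a point of the ball from this compact convex image
  would have a normal vector whose projection to \<open>lin A\<close> has margin above \<open>-r\<close>. Hence
  \<open>b - A x\<close>, scaled to length \<open>r\<close>, equals \<open>A p\<close> for some \<open>p\<close> in the simplex, and moving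
  from \<open>x\<close> by \<open>(\<parallel>A x - b\<parallel> / r) p\<close>, whose \<open>\<ell>\<^sub>1\<close>-norm is
  \<open>\<parallel>A x - b\<parallel> / r\<close>, reaches \<open>W\<close>.
\<close>

lemma l1_norm_nonneg: "0 \<le> l1_norm x"
  by (simp add: l1_norm_def sum_nonneg)

lemma l1_norm_scaleR: "l1_norm (c *\<^sub>R x) = \<bar>c\<bar> * l1_norm x"
  by (simp add: l1_norm_def abs_mult sum_distrib_left)

lemma l1_norm_minus: "l1_norm (- x) = l1_norm x"
  by (simp add: l1_norm_def)

text \<open>For \<open>0 \<le> p\<close> the absolute values in \<open>l1_norm\<close> drop out.
  What remains are linear conditions on the coordinates, from which convexity and closedness can be
  read off.\<close>

lemma prob_simplex_alt:
  "prob_simplex = {p :: real ^ 'n. (\<forall>i. 0 \<le> p $ i) \<and> (\<Sum>i\<in>UNIV. p $ i) = 1}"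
  by (auto simp: prob_simplex_def l1_norm_def less_eq_vec_def)

lemma convex_prob_simplex: "convex (prob_simplex :: (real ^ 'n) set)"
  by (rule convexI) (auto simp: prob_simplex_alt sum.distrib simp flip: sum_distrib_left)

lemma compact_prob_simplex: "compact (prob_simplex :: (real ^ 'n) set)"
  unfolding compact_eq_bounded_closed
proof
  show "bounded (prob_simplex :: (real ^ 'n) set)"
    unfolding bounded_iff
    by (rule exI[of _ 1]) (metis (mono_tags, lifting) l1_norm_def mem_Collect_eq norm_le_l1_cart prob_simplex_def)
  show "closed (prob_simplex :: (real ^ 'n) set)"
    unfolding prob_simplex_alt
    by (intro closed_Collect_conj closed_Collect_all closed_Collect_le closed_Collect_eq
        continuous_intros)
qed

lemma prob_simplex_nonempty: "(prob_simplex :: (real ^ 'n) set) \<noteq> {}"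
proof -
  have "axis undefined 1 \<in> (prob_simplex :: (real ^ 'n) set)"
    by (auto simp: prob_simplex_alt axis_def)
  then show ?thesis by blast
qed

lemma subspace_lin: "subspace (lin A)"
proof -
  have "lin A = range ((*v) A)"
    by (auto simp: lin_def)
  then show ?thesis
    by (simp add: linear_subspace_image)
qed

text \<open>The unit vector \<open>w /\<^sub>R norm w\<close> competes in the supremum, and
  normalizing divides the bound by \<open>norm w\<close>.\<close>

lemma affine_margin_lower_bound:
  fixes A :: "real ^ 'n ^ 'm"
  assumes "w \<in> lin A" "w \<noteq> 0" "\<And>p. p \<in> prob_simplex \<Longrightarrow> \<beta> \<le> w \<bullet> (A *v p)"
  shows "ereal (\<beta> / norm w) \<le> affine_margin A"
  unfolding affine_margin_def
proof (rule SUP_upper2)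
  show "w /\<^sub>R norm w \<in> {w \<in> lin A. norm w = 1}"
    using assms(1,2) subspace_lin[of A] by (simp add: subspace_scale)
  show "ereal (\<beta> / norm w) \<le> (INF p\<in>prob_simplex. ereal ((w /\<^sub>R norm w) \<bullet> (A *v p)))"
  proof (rule INF_greatest)
    fix p :: "real ^ 'n" assume "p \<in> prob_simplex"
    from divide_right_mono[OF assms(3)[OF this], of "norm w"]
    show "ereal (\<beta> / norm w) \<le> ereal ((w /\<^sub>R norm w) \<bullet> (A *v p))"
      by (simp add: divide_inverse mult.commute)
  qed
qed

lemma ball_subset_image_prob_simplex:
  fixes A :: "real ^ 'n ^ 'm"
  assumes margin: "affine_margin A \<le> ereal (- r)"
    and v: "v \<in> lin A" "norm v \<le> r"
  shows "v \<in> (*v) A ` prob_simplex"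
proof (rule ccontr)
  assume "v \<notin> (*v) A ` prob_simplex"
  moreover have "convex ((*v) A ` prob_simplex)"
    by (simp add: convex_linear_image convex_prob_simplex)
  moreover have "closed ((*v) A ` prob_simplex)"
    by (intro compact_imp_closed compact_continuous_image compact_prob_simplex
        linear_continuous_on) (simp add: linear_linear)
  ultimately obtain a \<beta> where
    sep: "a \<bullet> v < \<beta>" "\<And>p. p \<in> prob_simplex \<Longrightarrow> \<beta> < a \<bullet> (A *v p)"
    using separating_hyperplane_closed_point[of "(*v) A ` prob_simplex" v] by auto
  \<comment> \<open>The normal \<open>a\<close> may lie outside \<open>lin A\<close>, where the
    margin says nothing about it. Its orthogonal projection \<open>w\<close> has the same inner
    products with \<open>lin A\<close>, hence still separates.\<close>
  obtain w z where "w \<in> span (lin A)"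
    and orth: "\<And>u. u \<in> span (lin A) \<Longrightarrow> orthogonal z u" and a: "a = w + z"
    using orthogonal_subspace_decomp_exists[of "lin A" a] by metis
  have span: "span (lin A) = lin A"
    using subspace_lin by (simp add: span_eq_iff)
  with \<open>w \<in> span (lin A)\<close> have w: "w \<in> lin A" by simp
  have proj: "a \<bullet> u = w \<bullet> u" if "u \<in> lin A" for u
    using orth[of u] that by (simp add: span a inner_add_left orthogonal_def)
  have "A *v p \<in> lin A" for p
    by (auto simp: lin_def)
  then have sep': "w \<bullet> v < \<beta>" "\<And>p. p \<in> prob_simplex \<Longrightarrow> \<beta> < w \<bullet> (A *v p)"
    using sep proj v(1) by auto
  \<comment> \<open>With \<open>w = 0\<close>, any point of the simplex would give both
    \<open>0 < \<beta>\<close> and \<open>\<beta> < 0\<close>.\<close>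
  have "w \<noteq> 0"
    using sep' prob_simplex_nonempty by fastforce
  have "- r * norm w \<le> - norm v * norm w"
    using v(2) by (simp add: mult_right_mono)
  also have "\<dots> \<le> w \<bullet> v"
    using Cauchy_Schwarz_ineq2[of w v] by (simp add: mult.commute)
  finally have "- r < \<beta> / norm w"
    using sep'(1) \<open>w \<noteq> 0\<close> by (simp add: pos_less_divide_eq)
  moreover have "ereal (\<beta> / norm w) \<le> ereal (- r)"
    using affine_margin_lower_bound[OF w \<open>w \<noteq> 0\<close>, of \<beta>] sep'(2) margin
    by (meson less_imp_le order_trans)
  ultimately show False by simp
qed

lemma dist_l1_le: "y \<in> W \<Longrightarrow> dist_l1 x W \<le> l1_norm (x - y)"
  unfolding dist_l1_def by (rule cINF_lower) (auto intro: bdd_belowI2 l1_norm_nonneg)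

text \<open>Keeping \<open>r\<close> free, instead of fixing it as the absolute value of the margin,
  also covers a margin of minus infinity, where every positive \<open>r\<close> is
  admissible.\<close>

lemma dist_l1_le_residual:
  fixes A :: "real ^ 'n ^ 'm"
  assumes margin: "affine_margin A \<le> ereal (- r)" and "r > 0"
    and "b \<in> lin A" and "0 \<le> x"
  shows "dist_l1 x {y. 0 \<le> y \<and> A *v y = b} \<le> norm (A *v x - b) / r"
proof (cases "A *v x = b")
  \<comment> \<open>Here \<open>x\<close> itself lies in the solution set; the scaling below needs a
    nonzero residual.\<close>
  case True
  then show ?thesis
    using dist_l1_le[of x "{y. 0 \<le> y \<and> A *v y = b}" x] \<open>0 \<le> x\<close>
    by (simp add: l1_norm_def)
next
  case False
  \<comment> \<open>This \<open>t\<close> scales the residual to length exactly \<open>r\<close> and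
    is also the l1-length of the move \<open>t *\<^sub>R p\<close>.\<close>
  define t where "t = norm (A *v x - b) / r"
  have "t > 0"
    using False \<open>r > 0\<close> by (simp add: t_def)
  have "A *v x \<in> lin A"
    by (auto simp: lin_def)
  then have "(b - A *v x) /\<^sub>R t \<in> lin A"
    using \<open>b \<in> lin A\<close> subspace_lin[of A] by (intro subspace_scale subspace_diff)
  moreover have "norm ((b - A *v x) /\<^sub>R t) \<le> r"
    using False \<open>r > 0\<close> by (simp add: t_def norm_minus_commute)
  ultimately obtain p where p: "p \<in> prob_simplex" "(b - A *v x) /\<^sub>R t = A *v p"
    using ball_subset_image_prob_simplex[OF margin] by blast
  have "A *v (x + t *\<^sub>R p) = A *v x + t *\<^sub>R (A *v p)"
    by (simp add: matrix_vector_right_distrib matrix_vector_mult_scaleR)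
  also have "\<dots> = b"
    using \<open>t > 0\<close> by (simp flip: p(2))
  finally have "A *v (x + t *\<^sub>R p) = b" .
  moreover have "0 \<le> x + t *\<^sub>R p"
    using \<open>0 \<le> x\<close> \<open>t > 0\<close> p(1) by (simp add: prob_simplex_def less_eq_vec_def)
  ultimately have "dist_l1 x {y. 0 \<le> y \<and> A *v y = b} \<le> l1_norm (x - (x + t *\<^sub>R p))"
    by (intro dist_l1_le) simp
  also have "\<dots> = t"
    using \<open>t > 0\<close> p(1) by (simp add: l1_norm_minus l1_norm_scaleR prob_simplex_def)
  finally show ?thesis by (simp add: t_def)
qed

theorem theorem2:
  fixes A :: "real ^ 'n ^ 'm" and b :: "real ^ 'm" and W :: "(real ^ 'n) set"
  assumes "\<bar>affine_margin_neg A\<bar> > 0"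
    and "W = {x. 0 \<le> x \<and> A *v x = b}"
    and "W \<noteq> {}"
  shows "\<forall>x. 0 \<le> x \<longrightarrow>
    ereal (dist_l1 x W) \<le> ereal (norm (A *v x - b)) / \<bar>affine_margin_neg A\<bar>"
proof (intro allI impI)
  fix x :: "real ^ 'n" assume "0 \<le> x"
  have "b \<in> lin A"
    using assms(2,3) by (auto simp: lin_def)
  then have bound: "dist_l1 x W \<le> norm (A *v x - b) / r"
    if "affine_margin A \<le> ereal (- r)" "r > 0" for r
    using dist_l1_le_residual that \<open>0 \<le> x\<close> assms(2) by blast
  \<comment> \<open>A nonnegative margin would make \<open>affine_margin_neg A\<close> zero.\<close>
  have neg: "affine_margin A < 0"
    using assms(1) by (auto simp: affine_margin_neg_def min_def not_le split: if_splits)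
  then have eq: "affine_margin_neg A = affine_margin A"
    by (simp add: affine_margin_neg_def)
  show "ereal (dist_l1 x W) \<le> ereal (norm (A *v x - b)) / \<bar>affine_margin_neg A\<bar>"
  proof (cases "affine_margin A")
    case (real \<rho>)
    then show ?thesis
      using bound[of "- \<rho>"] neg by (simp add: eq)
  next
    case PInf
    then show ?thesis using neg by simp
  next
    \<comment> \<open>This is the case \<open>A = 0\<close>. The bound holds for all
      \<open>r > 0\<close>, so letting \<open>r\<close> tend to infinity gives distance at most 0,
      which matches division by infinity being 0.\<close>
    case MInf
    have "((\<lambda>r. norm (A *v x - b) / r) \<longlongrightarrow> 0) at_top"
      by (intro tendsto_divide_0[OF tendsto_const] filterlim_at_top_imp_at_infinity filterlim_ident)
    moreover have "eventually (\<lambda>r. dist_l1 x W \<le> norm (A *v x - b) / r) at_top"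
      using eventually_gt_at_top[of 0] by eventually_elim (simp add: bound MInf)
    ultimately have "dist_l1 x W \<le> 0"
      by (rule tendsto_lowerbound) simp
    then show ?thesis by (simp add: eq MInf)
  qed
qed

end
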